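(* Let $N\ge 1$ be an integer and consider the trigonometric grid $$x_s=-\cos\left(\frac{\pi(s+1/2)}{N+1}\right),\qquad s=0,1,\dots,N.$$ Then the two initial Sturmian polynomials on this grid are $P_{N+1}(x)=T_{N+1}(x)$ and $P_N(x)=U_N(x)$, and all further polynomials of the Sturmian sequence coincide with the monic Chebyshev polynomials of the second kind: $P_n(x)=U_n(x)$ for $n=0,1,\dots,N-1$. These polynomials satisfy the recurrence relation $$P_{n+1}(x)+u_nP_{n-1}(x)=xP_n(x),\qquad n=1,2,\dots,N,$$ with $u_1=u_2=\dots=u_{N-1}=\tfrac14$ and $u_N=\tfrac12$.
   Context: Sturmian sequence on a grid: given distinct real numbers $x_0,\dots,x_N$, put $P_{N+1}(x)=\prod_{s=0}^N(x-x_s)$ and $P_N(x)=(N+1)^{-1}P_{N+1}'(x)$ (the two initial polynomials). The Euclidean algorithm produces uniquely monic polynomials $P_{N-1},\dots,P_0=1$ ($\deg P_n=n$), real $b_n$ and $u_n>0$ with $P_{n+1}(x)=(x-b_n)P_n(x)-u_nP_{n-1}(x)$ for $n=1,\dots,N$, and $P_1(x)=x-b_0$. Monic Chebyshev polynomials, with $x=\cos\theta$: first kind $T_0=1$, $T_n(x)=2^{1-n}\cos(n\theta)$ for $n\ge1$; second kind $U_n(x)=2^{-n}\dfrac{\sin((n+1)\theta)}{\sin\theta}$ for $n\ge0$. *)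

theory Defs
  imports Complex_Main "HOL-Computational_Algebra.Polynomial"
begin

text \<open>The monic Chebyshev polynomials of both kinds are given by their trigonometric formulas under \<open>x = cos \<theta>\<close>; the existence and
  uniqueness required by the definite descriptions is proved below. The formula for the second
  kind is imposed only where \<open>sin \<theta>\<close> does not vanish.\<close>

definition monic_cheb_T :: "nat \<Rightarrow> real poly" where
  "monic_cheb_T n = (if n = 0 then 1 else
     (THE p. \<forall>\<theta>. poly p (cos \<theta>) = 2 powi (1 - int n) * cos (real n * \<theta>)))"

definition monic_cheb_U :: "nat \<Rightarrow> real poly" where
  "monic_cheb_U n =
     (THE p. \<forall>\<theta>. sin \<theta> \<noteq> 0 \<longrightarrow>
        poly p (cos \<theta>) = 2 powi (- int n) * (sin ((real n + 1) * \<theta>) / sin \<theta>))"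

lemma poly_eqI_cos:
  fixes p q :: "real poly"
  assumes "\<And>\<theta>. sin \<theta> \<noteq> 0 \<Longrightarrow> poly p (cos \<theta>) = poly q (cos \<theta>)"
  shows "p = q"
proof (rule ccontr)
  assume "p \<noteq> q"
  hence fin: "finite {x. poly (p - q) x = 0}"
    by (intro poly_roots_finite) simp
  have "{-1<..<1} \<subseteq> {x. poly (p - q) x = 0}"
  proof
    fix x :: real assume x: "x \<in> {-1<..<1}"
    hence "sin (arccos x) \<noteq> 0" by (intro sin_arccos_nonzero) auto
    thus "x \<in> {x. poly (p - q) x = 0}" using assms[of "arccos x"] x by simp
  qed
  with fin have "finite {-1<..<(1::real)}" by (rule finite_subset[rotated])
  thus False by (simp add: infinite_Ioo)
qed

lemma cos_poly_exists: "\<exists>p. \<forall>\<theta>::real. poly p (cos \<theta>) = cos (real n * \<theta>)"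
proof (induction n rule: less_induct)
  case (less n)
  consider "n = 0" | "n = 1" | m where "n = Suc (Suc m)"
    by (metis One_nat_def nat.exhaust)
  thus ?case
  proof cases
    case 1
    thus ?thesis by (intro exI[of _ 1]) simp
  next
    case 2
    thus ?thesis by (intro exI[of _ "[:0, 1:]"]) simp
  next
    case (3 m)
    obtain p where p: "\<And>\<theta>. poly p (cos \<theta>) = cos (real m * \<theta>)"
      using less.IH[of m] 3 by auto
    obtain q where q: "\<And>\<theta>. poly q (cos \<theta>) = cos (real (Suc m) * \<theta>)"
      using less.IH[of "Suc m"] 3 by auto
    have "cos (real n * \<theta>) = 2 * cos \<theta> * cos (real (Suc m) * \<theta>) - cos (real m * \<theta>)" for \<theta>
      using cos_add[of "real (Suc m) * \<theta>" \<theta>] cos_diff[of "real (Suc m) * \<theta>" \<theta>] 3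
      by (simp add: algebra_simps)
    thus ?thesis by (intro exI[of _ "[:0, 2:] * q - p"]) (simp add: p q)
  qed
qed

lemma sin_poly_exists:
  "\<exists>p. \<forall>\<theta>::real. poly p (cos \<theta>) * sin \<theta> = sin ((real n + 1) * \<theta>)"
proof (induction n)
  case 0
  show ?case by (intro exI[of _ 1]) simp
next
  case (Suc n)
  then obtain p where p: "\<And>\<theta>. poly p (cos \<theta>) * sin \<theta> = sin ((real n + 1) * \<theta>)" by auto
  obtain q where q: "\<And>\<theta>. poly q (cos \<theta>) = cos (real (Suc n) * \<theta>)"
    using cos_poly_exists by blast
  have "sin ((real (Suc n) + 1) * \<theta>)
      = sin ((real n + 1) * \<theta>) * cos \<theta> + cos (real (Suc n) * \<theta>) * sin \<theta>" for \<theta>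
    using sin_add[of "(real n + 1) * \<theta>" \<theta>] by (simp add: algebra_simps)
  hence "poly ([:0, 1:] * p + q) (cos \<theta>) * sin \<theta> = sin ((real (Suc n) + 1) * \<theta>)" for \<theta>
    by (simp only: p[symmetric] q[symmetric]) (simp add: algebra_simps)
  thus ?case by blast
qed

lemma ex1_monic_cheb_T:
  "\<exists>!p. \<forall>\<theta>::real. poly p (cos \<theta>) = 2 powi (1 - int n) * cos (real n * \<theta>)"
proof -
  obtain p where "\<And>\<theta>::real. poly p (cos \<theta>) = cos (real n * \<theta>)"
    using cos_poly_exists by blast
  hence "\<forall>\<theta>::real. poly (smult (2 powi (1 - int n)) p) (cos \<theta>)
      = 2 powi (1 - int n) * cos (real n * \<theta>)" by simp
  thus ?thesis
    by (intro ex_ex1I, intro exI[of _ "smult (2 powi (1 - int n)) p"], assumption)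
      (rule poly_eqI_cos, simp)
qed

lemma ex1_monic_cheb_U:
  "\<exists>!p. \<forall>\<theta>::real. sin \<theta> \<noteq> 0 \<longrightarrow>
     poly p (cos \<theta>) = 2 powi (- int n) * (sin ((real n + 1) * \<theta>) / sin \<theta>)"
proof -
  obtain p where "\<And>\<theta>::real. poly p (cos \<theta>) * sin \<theta> = sin ((real n + 1) * \<theta>)"
    using sin_poly_exists by blast
  hence "\<forall>\<theta>::real. sin \<theta> \<noteq> 0 \<longrightarrow> poly (smult (2 powi (- int n)) p) (cos \<theta>)
      = 2 powi (- int n) * (sin ((real n + 1) * \<theta>) / sin \<theta>)"
    by (auto simp: eq_divide_eq)
  thus ?thesis
    by (intro ex_ex1I, intro exI[of _ "smult (2 powi (- int n)) p"], assumption)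
      (rule poly_eqI_cos, simp)
qed

lemma poly_monic_cheb_T_cos:
  assumes "n \<ge> 1"
  shows "poly (monic_cheb_T n) (cos \<theta>) = 2 powi (1 - int n) * cos (real n * \<theta>)"
  using theI'[OF ex1_monic_cheb_T[of n]] assms by (simp add: monic_cheb_T_def)

lemma poly_monic_cheb_U_cos:
  assumes "sin \<theta> \<noteq> 0"
  shows "poly (monic_cheb_U n) (cos \<theta>) = 2 powi (- int n) * (sin ((real n + 1) * \<theta>) / sin \<theta>)"
  using theI'[OF ex1_monic_cheb_U[of n]] assms unfolding monic_cheb_U_def by blast

text \<open>The grid is \<open>x 0, \<dots>, x N\<close>. The function \<open>sturm_euclid x N\<close> lists the sequence downwards:
  its value at \<open>k\<close> is the polynomial of index \<open>N + 1 - k\<close>. Each Euclidean step divides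
  \<open>P\<^sub>n\<^sub>+\<^sub>1\<close> by \<open>P\<^sub>n\<close>; the remainder is \<open>- u\<^sub>n P\<^sub>n\<^sub>-\<^sub>1\<close> with \<open>P\<^sub>n\<^sub>-\<^sub>1\<close> monic.\<close>

definition grid_poly :: "(nat \<Rightarrow> real) \<Rightarrow> nat \<Rightarrow> real poly" where
  "grid_poly x N = (\<Prod>s = 0..N. [:- x s, 1:])"

definition make_monic :: "real poly \<Rightarrow> real poly" where
  "make_monic p = smult (inverse (lead_coeff p)) p"

fun sturm_euclid :: "(nat \<Rightarrow> real) \<Rightarrow> nat \<Rightarrow> nat \<Rightarrow> real poly" where
  "sturm_euclid x N 0 = grid_poly x N"
| "sturm_euclid x N (Suc 0) = smult (inverse (real N + 1)) (pderiv (grid_poly x N))"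
| "sturm_euclid x N (Suc (Suc k)) =
     make_monic (sturm_euclid x N k mod sturm_euclid x N (Suc k))"

text \<open>Meaningful for indices \<open>n \<le> N + 1\<close> and \<open>1 \<le> n \<le> N\<close>, respectively.\<close>

definition sturm_P :: "(nat \<Rightarrow> real) \<Rightarrow> nat \<Rightarrow> nat \<Rightarrow> real poly" where
  "sturm_P x N n = sturm_euclid x N (N + 1 - n)"

definition sturm_u :: "(nat \<Rightarrow> real) \<Rightarrow> nat \<Rightarrow> nat \<Rightarrow> real" where
  "sturm_u x N n = - lead_coeff (sturm_P x N (n + 1) mod sturm_P x N n)"

text \<open>Any monic polynomials and coefficients satisfying the three-term recurrence with the
  prescribed initial pair are the ones computed by the Euclidean algorithm.\<close>

lemma sturm_unique:
  fixes P :: "nat \<Rightarrow> real poly" and b u :: "nat \<Rightarrow> real"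
  assumes top: "P (N + 1) = grid_poly x N"
    and der: "P N = smult (inverse (real N + 1)) (pderiv (grid_poly x N))"
    and deg: "\<And>n. n \<le> N \<Longrightarrow> degree (P n) = n"
    and monic: "\<And>n. n \<le> N \<Longrightarrow> lead_coeff (P n) = 1"
    and u_pos: "\<And>n. 1 \<le> n \<Longrightarrow> n \<le> N \<Longrightarrow> u n > 0"
    and rec: "\<And>n. 1 \<le> n \<Longrightarrow> n \<le> N \<Longrightarrow>
                P (n + 1) = [:- b n, 1:] * P n - smult (u n) (P (n - 1))"
  shows "\<And>n. n \<le> N + 1 \<Longrightarrow> sturm_P x N n = P n"
    and "\<And>n. 1 \<le> n \<Longrightarrow> n \<le> N \<Longrightarrow> sturm_u x N n = u n"
proof -
  have md: "P (n + 1) mod P n = smult (- u n) (P (n - 1))" if n: "1 \<le> n" "n \<le> N" for n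
  proof -
    have "degree (smult (- u n) (P (n - 1))) < degree (P n)"
      using deg[of n] deg[of "n - 1"] n u_pos[of n] by simp
    hence "smult (- u n) (P (n - 1)) mod P n = smult (- u n) (P (n - 1))"
      by (rule mod_poly_less)
    moreover have "P (n + 1) = smult (- u n) (P (n - 1)) + [:- b n, 1:] * P n"
      using rec[OF n] by (simp add: algebra_simps)
    ultimately show ?thesis by (simp only: mod_mult_self1)
  qed
  have E: "sturm_euclid x N k = P (N + 1 - k)" if "k \<le> N + 1" for k
    using that
  proof (induction k rule: less_induct)
    case (less k)
    consider "k = 0" | "k = 1" | j where "k = Suc (Suc j)"
      by (metis One_nat_def nat.exhaust)
    thus ?case
    proof cases
      case (3 j)
      define n where "n = N - j"
      have n: "1 \<le> n" "n \<le> N" "N + 1 - j = n + 1" "N + 1 - Suc j = n" "N + 1 - k = n - 1"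
        using 3 less.prems by (auto simp: n_def)
      have "sturm_euclid x N j = P (n + 1)" "sturm_euclid x N (Suc j) = P n"
        using less.IH[of j] less.IH[of "Suc j"] 3 less.prems n by auto
      hence "sturm_euclid x N k = make_monic (smult (- u n) (P (n - 1)))"
        using 3 md[OF n(1,2)] by simp
      also have "\<dots> = P (n - 1)"
        using monic[of "n - 1"] u_pos[OF n(1,2)] n by (simp add: make_monic_def)
      finally show ?thesis using n by simp
    qed (use top der in auto)
  qed
  show P: "sturm_P x N n = P n" if "n \<le> N + 1" for n
    using E[of "N + 1 - n"] that by (simp add: sturm_P_def)
  show "sturm_u x N n = u n" if "1 \<le> n" "n \<le> N" for n
    using P[of n] P[of "n + 1"] md[OF that] monic[of "n - 1"] that
    by (simp add: sturm_u_def)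
qed

definition trig_grid :: "nat \<Rightarrow> nat \<Rightarrow> real" where
  "trig_grid N s = - cos (pi * (real s + 1/2) / (real N + 1))"

lemma inj_on_trig_grid: "inj_on (trig_grid N) {0..N}"
proof (rule inj_onI)
  fix s t assume st: "s \<in> {0..N}" "t \<in> {0..N}" and eq: "trig_grid N s = trig_grid N t"
  have rng: "0 \<le> pi * (real r + 1/2) / (real N + 1)" "pi * (real r + 1/2) / (real N + 1) \<le> pi"
    if "r \<in> {0..N}" for r
  proof -
    have "pi * (real r + 1/2) \<le> pi * (real N + 1)"
      using that by (intro mult_left_mono) auto
    thus "0 \<le> pi * (real r + 1/2) / (real N + 1)" "pi * (real r + 1/2) / (real N + 1) \<le> pi"
      by (simp, subst pos_divide_le_eq) linarith+
  qed
  have "cos (pi * (real s + 1/2) / (real N + 1)) = cos (pi * (real t + 1/2) / (real N + 1))"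
    using eq unfolding trig_grid_def by (rule neg_equal_iff_equal[THEN iffD1])
  hence "pi * (real s + 1/2) / (real N + 1) = pi * (real t + 1/2) / (real N + 1)"
    by (rule cos_inj_pi[OF rng[OF st(1)] rng[OF st(2)]])
  moreover have "real N + 1 \<noteq> 0" by linarith
  ultimately have "pi * (real s + 1/2) = pi * (real t + 1/2)"
    by (simp only: divide_cancel_right simp_thms)
  thus "s = t" by simp
qed

end

theory Submission
  imports Defs
begin

text \<open>
  In terms of the angle, the grid points are the images under \<open>x = cos \<theta>\<close> of the zeros of
  \<open>cos ((N + 1) \<theta>)\<close> (the minus sign only reverses their order), so the grid polynomial and the
  monic \<open>T\<close> of degree \<open>N + 1\<close> share \<open>N + 1\<close> distinct roots and a leading coefficient, whence they
  agree (\<open>grid_poly_trig_grid\<close>). Differentiating \<open>cos ((N + 1) \<theta>)\<close> with respect to \<open>\<theta>\<close> produces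
  \<open>sin ((N + 1) \<theta>)\<close>, so the second initial polynomial is of the second kind
  (\<open>pderiv_monic_cheb_T\<close>).

  From there on the Euclidean algorithm stays within the second kind. The addition theorem for
  \<open>sin (n \<theta> \<plusminus> \<theta>)\<close> gives the three-term recurrence of the second kind with constant coefficient
  \<open>1/4\<close> (\<open>monic_cheb_U_rec\<close>). The topmost step mixes the two kinds: only \<open>sin ((N + 1) \<theta> - \<theta>)\<close>
  is expanded there, and since \<open>2\<^sup>-\<^sup>N\<close> normalises both upper polynomials but \<open>2\<^sup>1\<^sup>-\<^sup>N\<close> the lower one,
  the coefficient is \<open>1/2\<close> (\<open>monic_cheb_T_rec\<close>). Monic polynomials of the right degrees
  satisfying the recurrences with positive coefficients are determined by the initial pair
  (\<open>sturm_unique\<close>), so these are the Sturmian data.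
\<close>

lemma poly_monic_cheb_T_cos_Suc:
  "poly (monic_cheb_T (Suc n)) (cos \<theta>) = cos ((real n + 1) * \<theta>) / 2 ^ n"
  using poly_monic_cheb_T_cos[of "Suc n" \<theta>]
  by (simp add: power_int_minus divide_inverse add.commute)

lemma poly_monic_cheb_U_cos_sin:
  assumes "sin \<theta> \<noteq> 0"
  shows "poly (monic_cheb_U n) (cos \<theta>) = sin ((real n + 1) * \<theta>) / (2 ^ n * sin \<theta>)"
  using poly_monic_cheb_U_cos[OF assms, of n]
  by (simp add: power_int_minus divide_simps)

lemma monic_cheb_U_0: "monic_cheb_U 0 = 1"
  by (rule poly_eqI_cos) (simp add: poly_monic_cheb_U_cos_sin)

lemma monic_cheb_U_1: "monic_cheb_U (Suc 0) = [:0, 1:]"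
  by (rule poly_eqI_cos) (simp add: poly_monic_cheb_U_cos_sin sin_double)

lemma monic_cheb_U_rec:
  "monic_cheb_U (Suc (Suc n)) = [:0, 1:] * monic_cheb_U (Suc n) - smult (1/4) (monic_cheb_U n)"
proof (rule poly_eqI_cos)
  fix \<theta> :: real assume s: "sin \<theta> \<noteq> 0"
  have "sin ((real n + 3) * \<theta>) = 2 * cos \<theta> * sin ((real n + 2) * \<theta>) - sin ((real n + 1) * \<theta>)"
    using sin_add[of "(real n + 2) * \<theta>" \<theta>] sin_diff[of "(real n + 2) * \<theta>" \<theta>]
    by (simp add: algebra_simps)
  then show "poly (monic_cheb_U (Suc (Suc n))) (cos \<theta>)
      = poly ([:0, 1:] * monic_cheb_U (Suc n) - smult (1/4) (monic_cheb_U n)) (cos \<theta>)"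
    using s by (simp add: poly_monic_cheb_U_cos_sin add.commute divide_simps)
qed

lemma monic_cheb_T_rec:
  "monic_cheb_T (Suc (Suc n)) = [:0, 1:] * monic_cheb_U (Suc n) - smult (1/2) (monic_cheb_U n)"
proof (rule poly_eqI_cos)
  fix \<theta> :: real assume s: "sin \<theta> \<noteq> 0"
  have "cos ((real n + 2) * \<theta>) * sin \<theta> = cos \<theta> * sin ((real n + 2) * \<theta>) - sin ((real n + 1) * \<theta>)"
    using sin_diff[of "(real n + 2) * \<theta>" \<theta>]
    by (simp add: algebra_simps)
  then show "poly (monic_cheb_T (Suc (Suc n))) (cos \<theta>)
      = poly ([:0, 1:] * monic_cheb_U (Suc n) - smult (1/2) (monic_cheb_U n)) (cos \<theta>)"
    using s
    by (simp add: poly_monic_cheb_U_cos_sin poly_monic_cheb_T_cos_Suc add.commute divide_simps)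
qed

lemma degree_lead_coeff_three_term:
  fixes p q :: "real poly"
  assumes "degree p = Suc n" "lead_coeff p = 1" "degree q = n"
  shows "degree ([:0, 1:] * p - smult c q) = Suc (Suc n)"
    and "lead_coeff ([:0, 1:] * p - smult c q) = 1"
proof -
  have p: "degree ([:0, 1:] * p) = Suc (Suc n)"
    using assms by (subst degree_mult_eq) auto
  have c: "coeff ([:0, 1:] * p - smult c q) (Suc (Suc n)) = 1"
    using assms by (simp add: coeff_eq_0)
  have "degree ([:0, 1:] * p - smult c q) \<le> Suc (Suc n)"
    using p assms by (intro degree_diff_le) (auto intro: order.trans[OF degree_smult_le])
  with c show d: "degree ([:0, 1:] * p - smult c q) = Suc (Suc n)"
    by (intro antisym le_degree) auto
  show "lead_coeff ([:0, 1:] * p - smult c q) = 1"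
    unfolding d by (rule c)
qed

lemma degree_lead_coeff_monic_cheb_U:
  "degree (monic_cheb_U n) = n \<and> lead_coeff (monic_cheb_U n) = 1"
proof (induction n rule: less_induct)
  case (less n)
  consider "n = 0" | "n = Suc 0" | m where "n = Suc (Suc m)"
    by (metis nat.exhaust)
  then show ?case
  proof cases
    case (3 m)
    then have "m < n" "Suc m < n"
      by simp_all
    then show ?thesis
      using less.IH[of m] less.IH[of "Suc m"]
        degree_lead_coeff_three_term[of "monic_cheb_U (Suc m)" m "monic_cheb_U m" "1/4"]
      unfolding 3 monic_cheb_U_rec by blast
  qed (simp_all add: monic_cheb_U_0 monic_cheb_U_1)
qed

lemma degree_lead_coeff_monic_cheb_T:
  "degree (monic_cheb_T (Suc (Suc n))) = Suc (Suc n)"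
  "lead_coeff (monic_cheb_T (Suc (Suc n))) = 1"
  using degree_lead_coeff_three_term[of "monic_cheb_U (Suc n)" n "monic_cheb_U n" "1/2"]
    degree_lead_coeff_monic_cheb_U[of n] degree_lead_coeff_monic_cheb_U[of "Suc n"]
  unfolding monic_cheb_T_rec by blast+

text \<open>Both sides of \<open>T (cos \<theta>) = cos ((n + 1) \<theta>) / 2\<^sup>n\<close> are differentiated with respect to \<open>\<theta>\<close>;
  the inner derivative \<open>- sin \<theta>\<close> becomes the denominator of the second kind.\<close>

lemma pderiv_monic_cheb_T:
  "pderiv (monic_cheb_T (Suc n)) = smult (real n + 1) (monic_cheb_U n)"
proof (rule poly_eqI_cos)
  fix \<theta> :: real assume s: "sin \<theta> \<noteq> 0"
  have "((\<lambda>\<theta>. poly (monic_cheb_T (Suc n)) (cos \<theta>)) has_real_derivative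
          poly (pderiv (monic_cheb_T (Suc n))) (cos \<theta>) * (- sin \<theta>)) (at \<theta>)"
    by (auto intro!: derivative_eq_intros DERIV_chain2[OF poly_DERIV])
  moreover have "((\<lambda>\<theta>. poly (monic_cheb_T (Suc n)) (cos \<theta>)) has_real_derivative
          - ((real n + 1) * sin ((real n + 1) * \<theta>)) / 2 ^ n) (at \<theta>)"
    unfolding poly_monic_cheb_T_cos_Suc by (auto intro!: derivative_eq_intros)
  ultimately have "poly (pderiv (monic_cheb_T (Suc n))) (cos \<theta>) * (- sin \<theta>)
          = - ((real n + 1) * sin ((real n + 1) * \<theta>)) / 2 ^ n"
    by (rule DERIV_unique)
  then show "poly (pderiv (monic_cheb_T (Suc n))) (cos \<theta>)
      = poly (smult (real n + 1) (monic_cheb_U n)) (cos \<theta>)"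
    using s by (simp add: poly_monic_cheb_U_cos_sin field_simps)
qed

lemma poly_monic_cheb_T_trig_grid: "poly (monic_cheb_T (Suc N)) (trig_grid N s) = 0"
proof -
  define \<phi> where "\<phi> = pi * (real s + 1/2) / (real N + 1)"
  \<comment> \<open>The reflected angle absorbs the minus sign of the grid; scaled by \<open>N + 1\<close> it is an odd
    multiple of \<open>\<pi>/2\<close>.\<close>
  have "trig_grid N s = cos (pi - \<phi>)"
    by (simp add: trig_grid_def \<phi>_def)
  moreover have "(real N + 1) * (pi - \<phi>) = of_int (2 * (int N - int s) + 1) * (pi / 2)"
    unfolding \<phi>_def by (simp add: field_simps)
  then have "cos ((real N + 1) * (pi - \<phi>)) = 0"
    unfolding cos_zero_iff_int by (metis even_plus_one_iff even_mult_iff even_numeral)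
  ultimately show ?thesis
    by (simp only: poly_monic_cheb_T_cos_Suc div_0)
qed

lemma grid_poly_trig_grid:
  assumes "N \<ge> 1"
  shows "grid_poly (trig_grid N) N = monic_cheb_T (Suc N)"
proof (rule poly_eqI_degree_lead_coeff[where n = "Suc N" and A = "trig_grid N ` {0..N}"])
  obtain m where m: "N = Suc m"
    using assms by (cases N) auto
  have d: "degree (grid_poly (trig_grid N) N) = Suc N"
    unfolding grid_poly_def by (subst degree_prod_sum_eq) auto
  moreover have "lead_coeff (grid_poly (trig_grid N) N) = 1"
    unfolding grid_poly_def by (simp add: lead_coeff_prod)
  ultimately show "coeff (grid_poly (trig_grid N) N) (Suc N) = coeff (monic_cheb_T (Suc N)) (Suc N)"
    using degree_lead_coeff_monic_cheb_T[of m] m by simp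
  show "card (trig_grid N ` {0..N}) \<ge> Suc N"
    by (simp add: card_image inj_on_trig_grid)
  show "degree (grid_poly (trig_grid N) N) \<le> Suc N" "degree (monic_cheb_T (Suc N)) \<le> Suc N"
    using d degree_lead_coeff_monic_cheb_T[of m] m by simp_all
  fix x assume "x \<in> trig_grid N ` {0..N}"
  then obtain s where s: "s \<in> {0..N}" "x = trig_grid N s"
    by auto
  then have "poly (grid_poly (trig_grid N) N) x = 0"
    unfolding grid_poly_def by (auto simp: poly_prod)
  with s show "poly (grid_poly (trig_grid N) N) x = poly (monic_cheb_T (Suc N)) x"
    by (simp add: poly_monic_cheb_T_trig_grid)
qed

theorem proposition7:
  fixes N :: nat
  assumes "N \<ge> 1"
  shows "sturm_P (trig_grid N) N (N + 1) = monic_cheb_T (N + 1)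
    \<and> sturm_P (trig_grid N) N N = monic_cheb_U N
    \<and> (\<forall>n\<in>{0..N - 1}. sturm_P (trig_grid N) N n = monic_cheb_U n)
    \<and> (\<forall>n\<in>{1..N}. sturm_P (trig_grid N) N (n + 1)
          + smult (sturm_u (trig_grid N) N n) (sturm_P (trig_grid N) N (n - 1))
        = [:0, 1:] * sturm_P (trig_grid N) N n)
    \<and> (\<forall>n\<in>{1..N - 1}. sturm_u (trig_grid N) N n = 1/4)
    \<and> sturm_u (trig_grid N) N N = 1/2"
proof -
  \<comment> \<open>The expected data, glued at the index where the kind changes.\<close>
  define P where "P = (\<lambda>n. if n \<le> N then monic_cheb_U n else monic_cheb_T n)"
  define u :: "nat \<Rightarrow> real" where "u = (\<lambda>n. if n = N then 1/2 else 1/4)"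
  have top: "P (N + 1) = grid_poly (trig_grid N) N"
    using assms by (simp add: P_def grid_poly_trig_grid)
  have der: "P N = smult (inverse (real N + 1)) (pderiv (grid_poly (trig_grid N) N))"
    using assms by (simp add: P_def grid_poly_trig_grid pderiv_monic_cheb_T)
  have deg: "degree (P n) = n" and monic: "lead_coeff (P n) = 1" if "n \<le> N" for n
    using that degree_lead_coeff_monic_cheb_U[of n] by (auto simp: P_def)
  have pos: "u n > 0" for n
    by (simp add: u_def)
  have rec: "P (n + 1) = [:- 0, 1:] * P n - smult (u n) (P (n - 1))"
    if n: "1 \<le> n" "n \<le> N" for n
  proof -
    obtain m where m: "n = Suc m"
      using n by (cases n) auto
    show ?thesis
    proof (cases "n = N")
      case True
      then show ?thesis
        using m monic_cheb_T_rec[of m] by (auto simp: P_def u_def)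
    next
      case False
      then show ?thesis
        using n m monic_cheb_U_rec[of m] by (simp add: P_def u_def)
    qed
  qed
  have sturm: "sturm_P (trig_grid N) N n = P n" if "n \<le> N + 1" for n
    by (rule sturm_unique(1)[where b = "\<lambda>_. 0", OF top der deg monic pos rec that])
  have coeff: "sturm_u (trig_grid N) N n = u n" if "1 \<le> n" "n \<le> N" for n
    by (rule sturm_unique(2)[where b = "\<lambda>_. 0", OF top der deg monic pos rec that])
  have "sturm_P (trig_grid N) N (n + 1)
          + smult (sturm_u (trig_grid N) N n) (sturm_P (trig_grid N) N (n - 1))
        = [:0, 1:] * sturm_P (trig_grid N) N n" if "n \<in> {1..N}" for n
    using rec[of n] sturm[of "n + 1"] sturm[of n] sturm[of "n - 1"] coeff[of n] that
    by auto
  moreover have "sturm_u (trig_grid N) N n = 1/4" if "n \<in> {1..N - 1}" for n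
    using coeff[of n] that by (auto simp: u_def)
  moreover have "sturm_u (trig_grid N) N N = 1/2"
    using coeff[of N] assms by (simp add: u_def)
  moreover have "sturm_P (trig_grid N) N n = monic_cheb_U n" if "n \<le> N" for n
    using sturm[of n] that by (simp add: P_def)
  moreover have "sturm_P (trig_grid N) N (N + 1) = monic_cheb_T (N + 1)"
    using sturm[of "N + 1"] by (simp add: P_def)
  ultimately show ?thesis
    by auto
qed

end
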